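(* (i) Let $\alpha\in(0,1]$, $r\in(0,1)$, $\mu>0$. Then the generalized gamma distribution with parameters $r,\alpha,\mu$ is a mixed exponential distribution; more precisely, $$G^*_{r,\alpha,\mu}\stackrel{d}{=} W_1\cdot\big(S_{\alpha,1}Z_{r,\mu}^{1/\alpha}\big)^{-1},$$ where the random variables $W_1$, $S_{\alpha,1}$, $Z_{r,\mu}$ on the right-hand side are independent. (ii) Let $\alpha>0$, $r>0$, $\mu>0$ with $\alpha r>1$. Then the generalized gamma distribution with parameters $r,\alpha,\mu$ cannot be represented as a mixed exponential distribution.
   Context: For $r>0$, $\lambda>0$ and real $\alpha\neq 0$, the generalized gamma (GG) distribution is the distribution on $[0,\infty)$ with density $g^*(x;r,\alpha,\lambda)=\frac{|\alpha|\lambda^r}{\Gamma(r)}x^{\alpha r-1}e^{-\lambda x^{\alpha}}$, $x\ge 0$; $G^*_{r,\alpha,\lambda}$ denotes a random variable with this density. $G_{r,\lambda}$ denotes a gamma random variable with density $\frac{\lambda^r}{\Gamma(r)}x^{r-1}e^{-\lambda x}$, $x\ge0$. $W_1$ is a standard exponential random variable. For $0<\alpha\le 1$, $S_{\alpha,1}$ denotes a random variable with the one-sided strictly stable distribution with characteristic function $\exp\{-|t|^{\alpha}\exp(-\tfrac12 i\pi\alpha\,\mathrm{sign}\,t)\}$ (for $\alpha=1$ this is the distribution degenerate at $1$). For $r\in(0,1)$ and $\mu>0$, $Z_{r,\mu}=\mu(G_{r,1}+G_{1-r,1})/G_{r,1}$ with $G_{r,1}$, $G_{1-r,1}$ independent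 (equivalently, $Z_{r,\mu}$ has density $\frac{\mu^r}{\Gamma(1-r)\Gamma(r)}\cdot\frac{\mathbf 1(z\ge\mu)}{(z-\mu)^r z}$). A distribution with distribution function $F$ on $[0,\infty)$ is called mixed exponential if $1-F(x)=\int_0^\infty e^{-zx}\,dH(z)$, $x\ge 0$, for some probability distribution $H$ on $(0,\infty)$, i.e. it is the distribution of $W_1/V$ for some positive random variable $V$ independent of $W_1$. *)

theory Defs
  imports "HOL-Probability.Probability"
begin

definition gg_density :: "real \<Rightarrow> real \<Rightarrow> real \<Rightarrow> real \<Rightarrow> real" where
  "gg_density r \<alpha> l x =
     (if 0 \<le> x then \<bar>\<alpha>\<bar> * l powr r / Gamma r * x powr (\<alpha> * r - 1) * exp (- l * x powr \<alpha>)
      else 0)"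

definition GG :: "real \<Rightarrow> real \<Rightarrow> real \<Rightarrow> real measure" where
  "GG r \<alpha> l = density lborel (\<lambda>x. ennreal (gg_density r \<alpha> l x))"

definition Exp1 :: "real measure" where
  "Exp1 = density lborel (\<lambda>x. ennreal (exponential_density 1 x))"

definition Z_density :: "real \<Rightarrow> real \<Rightarrow> real \<Rightarrow> real" where
  "Z_density r \<mu> z =
     (if \<mu> \<le> z then \<mu> powr r / (Gamma (1 - r) * Gamma r) / ((z - \<mu>) powr r * z) else 0)"

definition Zlaw :: "real \<Rightarrow> real \<Rightarrow> real measure" where
  "Zlaw r \<mu> = density lborel (\<lambda>z. ennreal (Z_density r \<mu> z))"

definition one_sided_stable :: "real \<Rightarrow> real measure \<Rightarrow> bool" where
  "one_sided_stable \<alpha> S \<longleftrightarrow> real_distribution S \<and>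
     (\<forall>t. char S t = exp (- complex_of_real (\<bar>t\<bar> powr \<alpha>)
                              * exp (- (1/2) * \<i> * complex_of_real (pi * \<alpha> * sgn t))))"

definition mixed_exponential :: "real measure \<Rightarrow> bool" where
  "mixed_exponential M \<longleftrightarrow> real_distribution M \<and> measure M {..<0} = 0 \<and>
     (\<exists>H. real_distribution H \<and> measure H {..0} = 0 \<and>
          (\<forall>x\<ge>0. measure M {x<..} = (\<integral>z. exp (- z * x) \<partial>H)))"

end

theory Submission
  imports Defs "HOL-Complex_Analysis.Complex_Analysis"
begin

text \<open>
  Write \<open>F z = exp (- z\<^sup>\<alpha>)\<close>, so that the characteristic function of the one-sided stable law is
  \<open>t \<mapsto> F (- \<i> t)\<close>. The map \<open>c \<mapsto> s (1 - c) / (1 + c)\<close> carries the unit disc to the right half-plane,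
  \<open>0\<close> to \<open>s\<close> and \<open>exp (2 \<pi> \<i> x)\<close> to \<open>- \<i> s tan (\<pi> x)\<close>. Hence for every bounded holomorphic
  \<open>F\<close> on the half-plane the mean of \<open>F (- \<i> s tan (\<pi> x))\<close> over \<open>x \<in> [0, 1]\<close> is \<open>F s\<close>,
  its mean against \<open>exp (2 \<pi> \<i> x)\<close> vanishes, and its mean against \<open>exp (- 2 \<pi> \<i> x)\<close> is a Taylor
  coefficient, which equals \<open>2 s y exp (- s y)\<close> for \<open>z \<mapsto> exp (- y z)\<close>. Applying this both to the
  \<open>F\<close> above and to \<open>z \<mapsto> exp (- |y| z)\<close>, and exchanging the order of integration, gives
  \<open>E exp (- s |S|) = exp (- s\<^sup>\<alpha>)\<close> and \<open>E [|S| exp (- s |S|); S < 0] = 0\<close>; so the stable law lives on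
  \<open>(0, \<infinity>)\<close> and has Laplace transform \<open>exp (- s\<^sup>\<alpha>)\<close>.

  For (i), conditioning on \<open>S\<close> and \<open>Z\<close> shows that the product has tail \<open>E exp (- x\<^sup>\<alpha> Z)\<close>. Writing
  \<open>exp (- x\<^sup>\<alpha> z)\<close> as the integral over \<open>v \<ge> x\<close> of \<open>\<alpha> v\<^bsup>\<alpha>-1\<^esup> z exp (- v\<^sup>\<alpha> z)\<close> and integrating out \<open>z\<close>
  first with a Gamma integral turns this into the generalized gamma tail.

  For (ii), a mixed exponential law gives the interval \<open>(c, c + h]\<close> at most the mass of \<open>(0, h]\<close>,
  whereas for \<open>\<alpha> r > 1\<close> the density tends to \<open>0\<close> at \<open>0\<close>.
\<close>

section \<open>Boundary values of bounded holomorphic functions\<close>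

definition unit_uniform :: "real measure" where
  "unit_uniform = density lborel (\<lambda>x. ennreal (indicator {0..1} x))"

lemma sets_unit_uniform [measurable_cong, simp]: "sets unit_uniform = sets borel"
  and space_unit_uniform [simp]: "space unit_uniform = UNIV"
  by (simp_all add: unit_uniform_def)

lemma prob_space_unit_uniform: "prob_space unit_uniform"
proof
  have "emeasure unit_uniform (space unit_uniform) = (\<integral>\<^sup>+x. indicator {0..1::real} x \<partial>lborel)"
    by (auto simp: unit_uniform_def emeasure_density ennreal_indicator)
  then show "emeasure unit_uniform (space unit_uniform) = 1" by simp
qed

lemma AE_unit_uniformI:
  assumes "finite A" and "\<And>x. x \<in> {0..1} \<Longrightarrow> x \<notin> A \<Longrightarrow> P x"
  shows "AE x in unit_uniform. P x"
proof -
  have "AE x in lborel. x \<notin> A"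
    using assms(1) by (intro AE_not_in) (rule finite_imp_null_set_lborel)
  then show ?thesis
    unfolding unit_uniform_def
    by (subst AE_density) (auto simp: indicator_def split: if_splits intro: assms(2) elim!: eventually_mono)
qed

lemma integral_unit_uniform_continuous:
  fixes f :: "real \<Rightarrow> complex"
  assumes "continuous_on {0..1} f" and [measurable]: "f \<in> borel_measurable borel"
  shows "(LINT x|unit_uniform. f x) = integral {0..1} f"
proof -
  have "(LINT x|unit_uniform. f x) = (LINT x:{0..1}|lborel. f x)"
    unfolding unit_uniform_def set_lebesgue_integral_def by (subst integral_density) auto
  also have "\<dots> = integral {0..1} f"
    by (intro set_borel_integral_eq_integral borel_integrable_atLeastAtMost' assms)
  finally show ?thesis .
qed

text \<open>Cauchy's formula for the \<open>k\<close>-th derivative on the circle of radius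
  \<open>\<rho>\<close>: with \<open>u = \<rho> exp (2 pi \<i> x)\<close> one has
  \<open>du = 2 pi \<i> u dx\<close>, which cancels one of the \<open>k + 1\<close> factors
  \<open>u\<close> in the denominator.\<close>

lemma Taylor_coefficient_circle_mean:
  assumes hol: "f holomorphic_on cball 0 \<rho>" and \<rho>: "0 < \<rho>"
  shows "(LINT x|unit_uniform. f (of_real \<rho> * exp (2 * of_real pi * \<i> * of_real x)) *
            exp (- of_nat k * (2 * of_real pi * \<i> * of_real x)))
         = of_real \<rho> ^ k * ((deriv ^^ k) f 0 / fact k)" (is "(LINT x|_. ?h x) = _")
proof -
  let ?c = "\<lambda>x::real. of_real \<rho> * exp (2 * of_real pi * \<i> * of_real x)"
  have cont_c: "continuous_on UNIV ?c" by (intro continuous_intros)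
  have c_in: "?c x \<in> cball 0 \<rho>" for x
    using \<rho> by (simp add: norm_mult)
  have cont: "continuous_on UNIV ?h"
    by (intro continuous_intros continuous_on_compose2[OF holomorphic_on_imp_continuous_on[OF hol]])
       (use c_in in auto)
  have "((\<lambda>u. f u / (u - 0) ^ Suc k) has_contour_integral (2 * pi * \<i>) / fact k * (deriv ^^ k) f 0)
          (circlepath 0 \<rho>)"
    using \<rho> by (intro Cauchy_has_contour_integral_higher_derivative_circlepath
        holomorphic_on_imp_continuous_on hol holomorphic_on_subset[OF hol]) auto
  then have "((\<lambda>x. f (circlepath 0 \<rho> x) / circlepath 0 \<rho> x ^ Suc k *
      vector_derivative (circlepath 0 \<rho>) (at x within {0..1})) has_integral
      (2 * pi * \<i>) / fact k * (deriv ^^ k) f 0) {0..1}"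
    by (simp add: has_contour_integral_def)
  then have "((\<lambda>x. (2 * pi * \<i>) / of_real \<rho> ^ k * ?h x) has_integral
      (2 * pi * \<i>) / fact k * (deriv ^^ k) f 0) {0..1}"
  proof (rule has_integral_eq[rotated])
    fix x :: real assume x: "x \<in> {0..1}"
    have e: "exp (- of_nat k * (2 * of_real pi * \<i> * of_real x)) =
        1 / exp (2 * of_real pi * \<i> * of_real x) ^ k"
      by (simp add: exp_minus exp_of_nat_mult divide_inverse)
    show "f (circlepath 0 \<rho> x) / circlepath 0 \<rho> x ^ Suc k *
        vector_derivative (circlepath 0 \<rho>) (at x within {0..1}) = (2 * pi * \<i>) / of_real \<rho> ^ k * ?h x"
      using x \<rho> unfolding e
      by (simp add: vector_derivative_circlepath01) (simp add: circlepath field_simps)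
  qed
  then have "integral {0..1} (\<lambda>x. (2 * pi * \<i>) / of_real \<rho> ^ k * ?h x) = 
      (2 * pi * \<i>) / fact k * (deriv ^^ k) f 0"
    by (rule integral_unique)
  then have "(2 * pi * \<i>) / of_real \<rho> ^ k * integral {0..1} ?h =
      (2 * pi * \<i>) / fact k * (deriv ^^ k) f 0"
    by (simp only: integral_mult_right)
  then have "integral {0..1} ?h = of_real \<rho> ^ k * ((deriv ^^ k) f 0 / fact k)"
    using \<rho> by (simp add: field_simps)
  moreover have "(LINT x|unit_uniform. ?h x) = integral {0..1} ?h"
    by (rule integral_unit_uniform_continuous[OF continuous_on_subset[OF cont subset_UNIV]
        borel_measurable_continuous_onI[OF cont]])
  ultimately show ?thesis by (simp only:)
qed

text \<open>Dominated convergence as the radius tends to \<open>1\<close>, with the constant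
  \<open>M\<close> as majorant. Radial limits off a finite set suffice, so \<open>f\<close> may be
  singular at finitely many boundary points.\<close>

lemma Taylor_coefficient_boundary_mean:
  fixes f :: "complex \<Rightarrow> complex" and g :: "real \<Rightarrow> complex"
  assumes hol: "f holomorphic_on ball 0 1"
    and bound: "\<And>z. norm z < 1 \<Longrightarrow> norm (f z) \<le> M"
    and [measurable]: "g \<in> borel_measurable borel"
    and "finite A"
    and lim: "\<And>x. x \<in> {0..1} \<Longrightarrow> x \<notin> A \<Longrightarrow>
      ((\<lambda>\<rho>. f (of_real \<rho> * exp (2 * of_real pi * \<i> * of_real x))) \<longlongrightarrow> g x) (at_left 1)"
  shows "(LINT x|unit_uniform. g x * exp (- of_nat k * (2 * of_real pi * \<i> * of_real x)))
         = (deriv ^^ k) f 0 / fact k" (is "(LINT x|_. g x * ?e x) = ?a")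
proof -
  interpret U: prob_space unit_uniform by (rule prob_space_unit_uniform)
  \<comment> \<open>Dominated convergence runs along a sequence; the offset \<open>2\<close> keeps
    \<open>\<rho> 0 = 1/2\<close> positive.\<close>
  define \<rho> where "\<rho> n = 1 - 1 / (real n + 2)" for n
  have \<rho>: "0 < \<rho> n" "\<rho> n < 1" for n by (auto simp: \<rho>_def field_simps)
  have "\<rho> \<longlonglongrightarrow> 1" unfolding \<rho>_def by real_asymp
  then have \<rho>_lim: "filterlim \<rho> (at_left 1) sequentially"
    using \<rho> by (auto simp: filterlim_at less_imp_neq intro!: always_eventually)
  let ?h = "\<lambda>n x. f (of_real (\<rho> n) * exp (2 * of_real pi * \<i> * of_real x)) * ?e x"
  have in_ball: "of_real (\<rho> n) * exp (2 * of_real pi * \<i> * of_real x) \<in> ball 0 1" for n and x :: real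
    using \<rho>[of n] by (simp add: norm_mult)
  have norm_e: "norm (?e x) = 1" for x :: real by simp
  have "(\<lambda>n. LINT x|unit_uniform. ?h n x) \<longlonglongrightarrow> (LINT x|unit_uniform. g x * ?e x)"
  proof (rule integral_dominated_convergence[where w = "\<lambda>_. M"])
    show "AE x in unit_uniform. (\<lambda>n. ?h n x) \<longlonglongrightarrow> g x * ?e x"
      by (rule AE_unit_uniformI[OF \<open>finite A\<close>])
         (intro tendsto_intros filterlim_compose[OF lim \<rho>_lim])
    show "AE x in unit_uniform. norm (?h n x) \<le> M" for n
      using in_ball norm_e by (auto simp: norm_mult intro!: bound)
    have cont: "continuous_on UNIV (?h n)" for n
      by (intro continuous_intros continuous_on_compose2[OF holomorphic_on_imp_continuous_on[OF hol]])
         (use in_ball in auto)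
    show "?h n \<in> borel_measurable unit_uniform" for n
      using borel_measurable_continuous_onI[OF cont] by (simp cong: measurable_cong_sets)
  qed auto
  moreover have "(LINT x|unit_uniform. ?h n x) = of_real (\<rho> n) ^ k * ?a" for n
    using \<rho>[of n] by (intro Taylor_coefficient_circle_mean holomorphic_on_subset[OF hol]) auto
  moreover have "(\<lambda>n. of_real (\<rho> n) ^ k * ?a) \<longlonglongrightarrow> of_real 1 ^ k * ?a"
    by (intro tendsto_intros \<open>\<rho> \<longlonglongrightarrow> 1\<close>)
  ultimately show ?thesis
    using LIMSEQ_unique by fastforce
qed

section \<open>The Cayley map from the disc to the half-plane\<close>

lemma Cayley_unit_circle:
  assumes "cos (pi * x) \<noteq> 0"
  shows "1 + exp (2 * of_real pi * \<i> * of_real x) \<noteq> 0"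
    and "(1 - exp (2 * of_real pi * \<i> * of_real x)) / (1 + exp (2 * of_real pi * \<i> * of_real x))
         = - (\<i> * of_real (tan (pi * x)))"
proof -
  let ?c = "complex_of_real (cos (pi * x))" and ?s = "complex_of_real (sin (pi * x))"
  have "exp (2 * of_real pi * \<i> * of_real x) = cis (pi * x) * cis (pi * x)"
    by (simp add: cis_conv_exp mult_exp_exp algebra_simps)
  also have "cis (pi * x) = ?c + \<i> * ?s"
    by (simp add: complex_eq_iff)
  finally have e: "exp (2 * of_real pi * \<i> * of_real x) = (?c + \<i> * ?s) * (?c + \<i> * ?s)" .
  \<comment> \<open>Replacing \<open>1\<close> by \<open>?c * ?c + ?s * ?s\<close> makes the sum and
    the difference factor with the common term \<open>?c + \<i> * ?s\<close>, which then cancels in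
    the quotient.\<close>
  have u: "?c * ?c + ?s * ?s = 1"
    by (metis of_real_1 of_real_add of_real_mult power2_eq_square sin_cos_squared_add2)
  have plus: "1 + exp (2 * of_real pi * \<i> * of_real x) = 2 * ?c * (?c + \<i> * ?s)"
    unfolding e by (subst u[symmetric]) (simp add: algebra_simps)
  have minus: "1 - exp (2 * of_real pi * \<i> * of_real x) = - 2 * \<i> * ?s * (?c + \<i> * ?s)"
    unfolding e by (subst u[symmetric]) (simp add: algebra_simps)
  have nz: "?c + \<i> * ?s \<noteq> 0"
    using assms by (simp add: complex_eq_iff)
  show "1 + exp (2 * of_real pi * \<i> * of_real x) \<noteq> 0"
    using assms nz by (simp add: plus)
  show "(1 - exp (2 * of_real pi * \<i> * of_real x)) / (1 + exp (2 * of_real pi * \<i> * of_real x))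
         = - (\<i> * of_real (tan (pi * x)))"
    proof -
    have "- 2 * \<i> * ?s * (?c + \<i> * ?s) / (2 * ?c * (?c + \<i> * ?s)) = - 2 * \<i> * ?s / (2 * ?c)"
      using nz by (rule mult_divide_mult_cancel_right)
    then show ?thesis
      unfolding plus minus by (simp add: tan_def)
  qed
qed

lemma Re_Cayley_pos:
  assumes "norm (z::complex) < 1"
  shows "Re ((1 - z) / (1 + z)) > 0"
proof -
  have "z \<noteq> -1" using assms by auto
  then have nz: "1 + z \<noteq> 0" by (simp add: add_eq_0_iff2 minus_equation_iff)
  have "(Re z)\<^sup>2 + (Im z)\<^sup>2 < 1"
    using assms by (simp add: cmod_def)
  \<comment> \<open>The left side is the numerator of the real part of
    \<open>(1 - z) / (1 + z)\<close> over the denominator \<open>|1 + z|^2\<close>; it equals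
    \<open>1 - |z|^2\<close>.\<close>
  then have "(1 - Re z) * (1 + Re z) - Im z * Im z > 0"
    by (simp add: algebra_simps power2_eq_square)
  then show ?thesis using nz
    by (simp add: Re_divide' complex_neq_0 cmod_power2[symmetric] divide_simps)
qed

text \<open>All three means are Taylor coefficients at \<open>0\<close> after pulling
  \<open>F\<close> back to the disc by the Cayley map. Boundary continuity is asked only off
  \<open>0\<close>, where the later choice \<open>z powr \<alpha>\<close> can have a branch
  point.\<close>

lemma half_plane_boundary_means:
  fixes F :: "complex \<Rightarrow> complex" and s :: real
  assumes s: "0 < s"
    and hol: "F holomorphic_on {z. Re z > 0}"
    and bound: "\<And>z. Re z > 0 \<Longrightarrow> norm (F z) \<le> M"
    and cont: "\<And>t::real. t \<noteq> 0 \<Longrightarrow> isCont F (- (\<i> * of_real t))"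
    and [measurable]: "(\<lambda>t::real. F (- (\<i> * of_real t))) \<in> borel_measurable borel"
  shows "(LINT x|unit_uniform. F (- (\<i> * of_real (s * tan (pi * x))))) = F (of_real s)"
    and "(LINT x|unit_uniform. F (- (\<i> * of_real (s * tan (pi * x)))) *
            exp (2 * of_real pi * \<i> * of_real x)) = 0"
    and "(LINT x|unit_uniform. F (- (\<i> * of_real (s * tan (pi * x)))) *
            exp (- (2 * of_real pi * \<i> * of_real x)))
         = deriv (\<lambda>z. F (of_real s * ((1 - z) / (1 + z)))) 0"
proof -
  let ?f = "\<lambda>z. F (of_real s * ((1 - z) / (1 + z)))"
  let ?g = "\<lambda>x. F (- (\<i> * of_real (s * tan (pi * x))))"
  let ?e = "\<lambda>x. exp (2 * of_real pi * \<i> * of_real x)"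
  \<comment> \<open>The parameters \<open>0\<close> and \<open>1\<close> give the boundary point
    \<open>0\<close>, and \<open>1/2\<close> gives infinity, the pole of the Cayley map.\<close>
  define A :: "real set" where "A = {0, 1/2, 1}"
  have "finite A" by (simp add: A_def)
  have Re_pos: "Re (of_real s * ((1 - z) / (1 + z))) > 0" if "norm z < 1" for z
    using mult_pos_pos[OF s Re_Cayley_pos[OF that]] by (simp del: times_divide_eq_right)
  have nz: "1 + z \<noteq> 0" if "norm z < 1" for z :: complex
    using that by (metis add_eq_0_iff less_irrefl norm_minus_cancel norm_one)
  have hol_f: "?f holomorphic_on ball 0 1"
    by (rule holomorphic_on_compose_gen[OF _ hol, unfolded o_def])
       (use Re_pos nz in \<open>auto intro!: holomorphic_intros\<close>)
  have bound_f: "norm (?f z) \<le> M" if "norm z < 1" for z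
    using Re_pos[OF that] by (rule bound)
  have meas [measurable]: "?g \<in> borel_measurable borel"
  proof -
    have "(\<lambda>x. s * tan (pi * x)) \<in> borel_measurable borel"
      unfolding tan_def by measurable
    then show ?thesis by measurable
  qed
  have lim: "((\<lambda>\<rho>. ?f (of_real \<rho> * ?e x)) \<longlongrightarrow> ?g x) (at_left 1)"
    if x: "x \<in> {0..1}" "x \<notin> A" for x
  proof -
    have sin: "sin (pi * x) \<noteq> 0"
      using x sin_gt_zero[of "pi * x"] by (auto simp: A_def)
    have cos: "cos (pi * x) \<noteq> 0"
    proof
      assume "cos (pi * x) = 0"
      then obtain i where i: "pi * x = of_int i * (pi / 2)" "odd i"
        by (auto simp: cos_zero_iff_int)
      then have "x = of_int i / 2" by simp
      with x i(2) show False
        by (auto simp: A_def)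
    qed
    have "((\<lambda>\<rho>. of_real s * ((1 - of_real \<rho> * ?e x) / (1 + of_real \<rho> * ?e x))) \<longlongrightarrow>
        of_real s * ((1 - of_real 1 * ?e x) / (1 + of_real 1 * ?e x))) (at_left 1)"
      using Cayley_unit_circle(1)[OF cos] by (intro tendsto_intros) auto
    then have "((\<lambda>\<rho>. of_real s * ((1 - of_real \<rho> * ?e x) / (1 + of_real \<rho> * ?e x))) \<longlongrightarrow>
        - (\<i> * of_real (s * tan (pi * x)))) (at_left 1)"
      using Cayley_unit_circle(2)[OF cos] by (simp add: mult.left_commute)
    moreover have "s * tan (pi * x) \<noteq> 0"
      using s sin cos by (simp add: tan_def)
    ultimately show ?thesis
      by (intro isCont_tendsto_compose[OF cont])
  qed
  show "(LINT x|unit_uniform. ?g x) = F (of_real s)"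
    using Taylor_coefficient_boundary_mean[OF hol_f bound_f meas \<open>finite A\<close> lim, of 0] by simp
  show "(LINT x|unit_uniform. ?g x * exp (- (2 * of_real pi * \<i> * of_real x))) = deriv ?f 0"
    using Taylor_coefficient_boundary_mean[OF hol_f bound_f meas \<open>finite A\<close> lim, of 1] by simp
  \<comment> \<open>Multiplying by \<open>?e x\<close> turns \<open>?g\<close> into the boundary
    function of \<open>?f z * z\<close>, whose value at \<open>0\<close> vanishes.\<close>
  have "(LINT x|unit_uniform. ?g x * ?e x * exp (- of_nat 0 * (2 * of_real pi * \<i> * of_real x)))
      = (deriv ^^ 0) (\<lambda>z. ?f z * z) 0 / fact 0"
  proof (rule Taylor_coefficient_boundary_mean[OF _ _ _ \<open>finite A\<close>])
    show "(\<lambda>z. ?f z * z) holomorphic_on ball 0 1"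
      by (intro holomorphic_intros hol_f)
    show "norm (?f z * z) \<le> M" if "norm z < 1" for z
    proof -
      have "norm (?f z) * norm z \<le> norm (?f z) * 1"
        using that by (intro mult_left_mono) auto
      then show ?thesis using bound_f[OF that] by (simp add: norm_mult)
    qed
    show "((\<lambda>\<rho>. ?f (of_real \<rho> * ?e x) * (of_real \<rho> * ?e x)) \<longlongrightarrow> ?g x * ?e x) (at_left 1)"
      if "x \<in> {0..1}" "x \<notin> A" for x
    proof -
      have "((\<lambda>\<rho>. of_real \<rho> * ?e x) \<longlongrightarrow> of_real 1 * ?e x) (at_left 1)"
        by (intro tendsto_intros)
      then show ?thesis by (intro tendsto_mult lim that) simp
    qed
  qed measurable
  then show "(LINT x|unit_uniform. ?g x * ?e x) = 0" by simp
qed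

text \<open>These are the half-plane means of \<open>exp (- |y| z)\<close>. For negative
  \<open>y\<close> everything is conjugated, which exchanges \<open>exp (2 pi \<i> x)\<close> with
  its inverse; so the second mean is nonzero exactly for \<open>y < 0\<close> and later detects mass
  there.\<close>

lemma exp_tan_means:
  fixes s y :: real
  assumes s: "0 < s"
  shows "(LINT x|unit_uniform. exp (\<i> * of_real (s * tan (pi * x) * y))) = of_real (exp (- s * \<bar>y\<bar>))"
    and "(LINT x|unit_uniform. exp (\<i> * of_real (s * tan (pi * x) * y)) *
            exp (2 * of_real pi * \<i> * of_real x)) = of_real (if 0 \<le> y then 0 else 2 * s * \<bar>y\<bar> * exp (- s * \<bar>y\<bar>))"
proof -
  let ?F = "\<lambda>z. exp (- of_real \<bar>y\<bar> * z) :: complex"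
  let ?E = "\<lambda>x y. exp (\<i> * of_real (s * tan (pi * x) * y))"
  let ?e = "\<lambda>x. exp (2 * of_real pi * \<i> * of_real x)"
  have hol: "?F holomorphic_on {z. Re z > 0}" by (intro holomorphic_intros)
  have bound: "norm (?F z) \<le> 1" if "Re z > 0" for z
    using that by simp
  have cont: "isCont ?F z" for z by (intro continuous_intros)
  have meas: "(\<lambda>t::real. ?F (- (\<i> * of_real t))) \<in> borel_measurable borel" by measurable
  note M = half_plane_boundary_means[OF s hol bound cont meas]
  have F_eq: "?F (- (\<i> * of_real (s * tan (pi * x)))) = ?E x \<bar>y\<bar>" for x
    by (simp add: algebra_simps)
  have cnj_E: "cnj (?E x y) = ?E x (- y)" for x y
    by (simp add: exp_cnj)
  have cnj_e: "cnj (?e x) = exp (- (2 * of_real pi * \<i> * of_real x))" for x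
    by (simp add: exp_cnj)
  have M1: "(LINT x|unit_uniform. ?E x \<bar>y\<bar>) = of_real (exp (- s * \<bar>y\<bar>))"
    using M(1) unfolding F_eq by (simp add: exp_of_real[symmetric] mult.commute)
  show "(LINT x|unit_uniform. ?E x y) = of_real (exp (- s * \<bar>y\<bar>))"
  proof (cases "0 \<le> y")
    case True
    then show ?thesis using M1 by simp
  next
    case False
    have "(LINT x|unit_uniform. ?E x y) = (LINT x|unit_uniform. cnj (?E x \<bar>y\<bar>))"
      using False unfolding cnj_E by simp
    also have "\<dots> = cnj (LINT x|unit_uniform. ?E x \<bar>y\<bar>)"
      by (rule Bochner_Integration.integral_cnj)
    finally show ?thesis unfolding M1 by simp
  qed
  \<comment> \<open>The Cayley quotient has derivative \<open>-2\<close> at \<open>0\<close>; the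
    chain rule then supplies the factor \<open>2 * s * |y|\<close>.\<close>
  have D: "deriv (\<lambda>z. ?F (of_real s * ((1 - z) / (1 + z)))) 0 = of_real (2 * s * \<bar>y\<bar> * exp (- s * \<bar>y\<bar>))"
    by (rule DERIV_imp_deriv) (auto intro!: derivative_eq_intros simp: exp_of_real[symmetric] algebra_simps)
  show "(LINT x|unit_uniform. ?E x y * ?e x) = of_real (if 0 \<le> y then 0 else 2 * s * \<bar>y\<bar> * exp (- s * \<bar>y\<bar>))"
  proof (cases "0 \<le> y")
    case True
    then show ?thesis using M(2) unfolding F_eq by simp
  next
    case False
    have "(LINT x|unit_uniform. ?E x y * ?e x) =
        (LINT x|unit_uniform. cnj (?E x \<bar>y\<bar> * exp (- (2 * of_real pi * \<i> * of_real x))))"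
      using False unfolding complex_cnj_mult cnj_E cnj_e[symmetric] complex_cnj_cnj by simp
    also have "\<dots> = cnj (LINT x|unit_uniform. ?E x \<bar>y\<bar> * exp (- (2 * of_real pi * \<i> * of_real x)))"
      by (rule Bochner_Integration.integral_cnj)
    also have "\<dots> = cnj (of_real (2 * s * \<bar>y\<bar> * exp (- s * \<bar>y\<bar>)))"
      using M(3) unfolding F_eq D by simp
    finally show ?thesis using False by simp
  qed
qed

section \<open>The one-sided stable law\<close>

text \<open>The argument of \<open>z\<close> is below \<open>pi / 2\<close> in modulus, and
  multiplying it by \<open>\<alpha> \<le> 1\<close> keeps its cosine nonnegative; hence
  \<open>z powr \<alpha>\<close> has nonnegative real part.\<close>

lemma norm_exp_minus_powr_le_1:
  assumes "0 < \<alpha>" "\<alpha> \<le> 1" "Re z > 0"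
  shows "norm (exp (- (z powr of_real \<alpha>))) \<le> 1"
proof -
  have "z \<noteq> 0" using assms by auto
  then have "\<bar>Im (Ln z)\<bar> < pi / 2"
    using assms Re_Ln_pos_lt by blast
  then have "\<alpha> * \<bar>Im (Ln z)\<bar> \<le> 1 * (pi / 2)"
    using assms by (intro mult_mono) auto
  then have "\<bar>\<alpha> * Im (Ln z)\<bar> \<le> pi / 2"
    using assms by (simp add: abs_mult)
  then have "cos (\<alpha> * Im (Ln z)) \<ge> 0"
    by (intro cos_ge_zero) auto
  then have "Re (z powr of_real \<alpha>) \<ge> 0"
    using \<open>z \<noteq> 0\<close> by (simp add: powr_def Re_exp)
  then show ?thesis by simp
qed

text \<open>For \<open>t \<noteq> 0\<close> the argument of \<open>- \<i> t\<close> is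
  \<open>- sgn t * pi / 2\<close>, so the principal power reproduces the phase in the stable
  characteristic function. At \<open>t = 0\<close> both powers are \<open>0\<close> by
  convention.\<close>

lemma one_sided_stable_char:
  assumes "one_sided_stable \<alpha> S"
  shows "char S t = exp (- ((- (\<i> * of_real t)) powr of_real \<alpha>))"
proof -
  have "(- (\<i> * of_real t)) powr of_real \<alpha> =
      of_real (\<bar>t\<bar> powr \<alpha>) * exp (- (1/2) * \<i> * of_real (pi * \<alpha> * sgn t))"
  proof (cases t "0::real" rule: linorder_cases)
    case less
    have "Ln (- (\<i> * of_real t)) = Ln (of_real \<bar>t\<bar> * \<i>)"
      using less by (simp add: mult.commute)
    also have "\<dots> = of_real (ln \<bar>t\<bar>) + \<i> * of_real pi / 2"
      using Ln_times_of_real[of "\<bar>t\<bar>" \<i>] Ln_of_real[of "\<bar>t\<bar>"] less by (simp del: of_real_minus)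
    finally show ?thesis using less
      by (simp add: powr_def exp_of_real[symmetric] exp_add[symmetric] algebra_simps)
  next
    case greater
    have "Ln (- (\<i> * of_real t)) = Ln (of_real t * (- \<i>))"
      by (simp add: mult.commute)
    also have "\<dots> = of_real (ln t) - \<i> * of_real pi / 2"
      using greater by (subst Ln_times_of_real) (auto simp: Ln_of_real)
    finally have "Ln (- (\<i> * of_real t)) = of_real (ln t) - \<i> * of_real pi / 2" .
    then show ?thesis using greater
      by (simp add: powr_def) (simp add: exp_of_real[symmetric] exp_add[symmetric] algebra_simps)
  qed simp
  then show ?thesis
    using assms by (simp add: one_sided_stable_def)
qed

text \<open>Fubini, for an integrand of modulus at most \<open>1\<close> on a product of two
  probability spaces. The weight \<open>h\<close> will be \<open>1\<close> or
  \<open>exp (2 pi \<i> x)\<close>.\<close>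

lemma char_tan_mean:
  fixes h :: "real \<Rightarrow> complex"
  assumes "real_distribution S" and [measurable]: "h \<in> borel_measurable borel"
    and h: "\<And>x. norm (h x) \<le> 1"
  shows "(LINT x|unit_uniform. char S (s * tan (pi * x)) * h x) =
         (LINT y|S. LINT x|unit_uniform. exp (\<i> * of_real (s * tan (pi * x) * y)) * h x)"
proof -
  interpret S: real_distribution S by fact
  interpret U: prob_space unit_uniform by (rule prob_space_unit_uniform)
  interpret P: pair_prob_space unit_uniform S ..
  have [measurable]: "(\<lambda>x::real. tan (pi * x)) \<in> borel_measurable borel"
    unfolding tan_def by measurable
  let ?f = "\<lambda>x y. exp (\<i> * of_real (s * tan (pi * x) * y)) * h x"
  have "integrable (unit_uniform \<Otimes>\<^sub>M S) (case_prod ?f)"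
    by (rule P.integrable_const_bound[where B = 1]) (use h in \<open>auto simp: norm_mult\<close>)
  from P.Fubini_integral[OF this] show ?thesis
    by (simp add: char_def)
qed

text \<open>The same mean of \<open>char S (s tan (pi x))\<close> is computed twice: through
  holomorphy of \<open>exp (- z^\<alpha>)\<close>, and by integrating over \<open>x\<close> first
  for fixed \<open>y\<close>. The unweighted mean sees only \<open>|y|\<close>; the weighted one
  carries the sign.\<close>

lemma one_sided_stable_Laplace_abs:
  assumes S: "one_sided_stable \<alpha> S" and \<alpha>: "0 < \<alpha>" "\<alpha> \<le> 1" and s: "0 < s"
  shows "(LINT y|S. exp (- s * \<bar>y\<bar>)) = exp (- (s powr \<alpha>))"
    and "(LINT y|S. (if 0 \<le> y then 0 else 2 * s * \<bar>y\<bar> * exp (- s * \<bar>y\<bar>))) = 0"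
proof -
  interpret S: real_distribution S using S by (simp add: one_sided_stable_def)
  let ?F = "\<lambda>z. exp (- (z powr of_real \<alpha>)) :: complex"
  have hol: "?F holomorphic_on {z. Re z > 0}"
    by (intro holomorphic_intros) (auto simp: complex_nonpos_Reals_iff)
  have cont: "isCont ?F (- (\<i> * of_real t))" if "t \<noteq> 0" for t
    using that by (intro continuous_intros) (auto simp: complex_nonpos_Reals_iff)
  have char: "?F (- (\<i> * of_real t)) = char S t" for t
    using one_sided_stable_char[OF S] by simp
  have meas: "(\<lambda>t::real. ?F (- (\<i> * of_real t))) \<in> borel_measurable borel"
    unfolding char by (rule S.char_measurable)
  note M = half_plane_boundary_means[OF s hol norm_exp_minus_powr_le_1[OF \<alpha>] cont meas, unfolded char]
  have "complex_of_real (LINT y|S. exp (- s * \<bar>y\<bar>)) =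
      (LINT y|S. LINT x|unit_uniform. exp (\<i> * of_real (s * tan (pi * x) * y)))"
    unfolding exp_tan_means(1)[OF s] by simp
  also have "\<dots> = ?F (of_real s)"
    using char_tan_mean[OF S.real_distribution_axioms, of "\<lambda>_. 1" s] M(1) by simp
  also have "\<dots> = of_real (exp (- (s powr \<alpha>)))"
    using s by (simp add: powr_of_real exp_of_real[symmetric])
  finally show "(LINT y|S. exp (- s * \<bar>y\<bar>)) = exp (- (s powr \<alpha>))"
    by (simp only: of_real_eq_iff)
  have "complex_of_real (LINT y|S. (if 0 \<le> y then 0 else 2 * s * \<bar>y\<bar> * exp (- s * \<bar>y\<bar>))) =
      (LINT y|S. LINT x|unit_uniform. exp (\<i> * of_real (s * tan (pi * x) * y)) *
         exp (2 * of_real pi * \<i> * of_real x))"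
    unfolding exp_tan_means(2)[OF s] by simp
  also have "\<dots> = 0"
    using char_tan_mean[OF S.real_distribution_axioms, of "\<lambda>x. exp (2 * of_real pi * \<i> * of_real x)" s]
      M(2) by simp
  finally show "(LINT y|S. (if 0 \<le> y then 0 else 2 * s * \<bar>y\<bar> * exp (- s * \<bar>y\<bar>))) = 0"
    by (simp only: of_real_eq_0_iff)
qed

text \<open>A nonnegative function with zero mean that is positive for \<open>y < 0\<close> excludes
  negative values. An atom at \<open>0\<close> would bound \<open>E exp (- s |y|)\<close> from below
  for all \<open>s > 0\<close>, but this expectation tends to \<open>0\<close>.\<close>

lemma one_sided_stable_pos:
  assumes S: "one_sided_stable \<alpha> S" and \<alpha>: "0 < \<alpha>" "\<alpha> \<le> 1"
  shows "AE y in S. 0 < y"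
proof -
  interpret S: real_distribution S using S by (simp add: one_sided_stable_def)
  \<comment> \<open>The case \<open>s = 1\<close>; the factors \<open>1\<close> are kept so that the
    term matches that instance literally.\<close>
  let ?q = "\<lambda>y::real. if 0 \<le> y then 0 else 2 * 1 * \<bar>y\<bar> * exp (- 1 * \<bar>y\<bar>)"
  have "integrable S ?q"
  proof (rule S.integrable_const_bound[where B = 2])
    have le_1: "\<bar>y\<bar> * exp (- \<bar>y\<bar>) \<le> 1" for y :: real
      using order_trans[OF _ exp_ge_add_one_self[of "\<bar>y\<bar>"], of "\<bar>y\<bar>"]
      by (simp add: exp_minus field_simps)
    have "norm (?q y) \<le> 2" for y
      using le_1[of y] by (cases "0 \<le> y") (auto simp: abs_mult mult.assoc)
    then show "AE y in S. norm (?q y) \<le> 2" by blast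
  qed simp
  then have "AE y in S. ?q y = 0"
    by (rule integral_nonneg_eq_0_iff_AE[THEN iffD1, OF _ _ one_sided_stable_Laplace_abs(2)[OF S \<alpha>]])
       (auto intro!: AE_I2 simp: mult_nonpos_nonneg)
  then have nonneg: "AE y in S. 0 \<le> y"
    by eventually_elim (auto split: if_splits)
  have le: "measure S {0} \<le> exp (- (s powr \<alpha>))" if "0 < s" for s
  proof -
    have "measure S {0} = (LINT y|S. indicator {0} y)" by simp
    also have "\<dots> \<le> (LINT y|S. exp (- s * \<bar>y\<bar>))"
      using that by (intro integral_mono S.integrable_const_bound[where B = 1])
        (auto simp: indicator_def)
    finally show ?thesis using one_sided_stable_Laplace_abs(1)[OF S \<alpha> that] by simp
  qed
  have "((\<lambda>s. exp (- (s powr \<alpha>))) \<longlongrightarrow> 0) at_top"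
    using \<alpha> by real_asymp
  then have "measure S {0} \<le> 0"
    by (rule tendsto_lowerbound) (use le in \<open>auto intro: eventually_mono[OF eventually_gt_at_top[of 0]]\<close>)
  then have "emeasure S {0} = 0"
    by (simp add: S.emeasure_eq_measure measure_le_0_iff)
  then have "AE y in S. y \<noteq> 0"
    by (intro AE_I[where N = "{0}"]) auto
  with nonneg show ?thesis by eventually_elim auto
qed

text \<open>Positivity removes the modulus. At \<open>s = 0\<close> this is total mass one, as
  \<open>0 powr \<alpha> = 0\<close>.\<close>

lemma one_sided_stable_Laplace:
  assumes S: "one_sided_stable \<alpha> S" and \<alpha>: "0 < \<alpha>" "\<alpha> \<le> 1" and s: "0 \<le> s"
  shows "(LINT y|S. exp (- s * y)) = exp (- (s powr \<alpha>))"
proof -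
  interpret S: real_distribution S using S by (simp add: one_sided_stable_def)
  have "(LINT y|S. exp (- s * y)) = (LINT y|S. exp (- s * \<bar>y\<bar>))"
    using eventually_mono[OF one_sided_stable_pos[OF S \<alpha>]]
    by (intro integral_cong_AE) auto
  then show ?thesis
    using one_sided_stable_Laplace_abs(1)[OF S \<alpha>, of s] s S.prob_space by (cases "s = 0") auto
qed

section \<open>The generalized gamma law\<close>

lemma nn_integral_Gamma_scaled:
  fixes a c :: real
  assumes a: "0 < a" and c: "0 < c"
  shows "(\<integral>\<^sup>+t. ennreal (indicator {0..} t * t powr (a - 1) * exp (- c * t)) \<partial>lborel) =
         ennreal (Gamma a / c powr a)"
proof -
  have "ennreal (Gamma a) = (\<integral>\<^sup>+t. ennreal (indicator {0..} t * t powr (a - 1) / exp t) \<partial>lborel)"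
    using Gamma_conv_nn_integral_real[OF a] .
  also have "\<dots> = ennreal c * (\<integral>\<^sup>+t. ennreal (indicator {0..} (0 + c * t) * (0 + c * t) powr (a - 1) / exp (0 + c * t)) \<partial>lborel)"
    using c by (subst nn_integral_real_affine[where c = c and t = 0]) auto
  also have "\<dots> = ennreal c * (\<integral>\<^sup>+t. ennreal (c powr (a - 1)) *
      ennreal (indicator {0..} t * t powr (a - 1) * exp (- c * t)) \<partial>lborel)"
  proof (intro arg_cong2[where f = "(*)"] nn_integral_cong refl)
    fix t :: real
    show "ennreal (indicator {0..} (0 + c * t) * (0 + c * t) powr (a - 1) / exp (0 + c * t)) =
        ennreal (c powr (a - 1)) * ennreal (indicator {0..} t * t powr (a - 1) * exp (- c * t))"
      using c by (cases "0 \<le> t")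
        (auto simp: ennreal_mult'[symmetric] powr_mult exp_minus field_simps indicator_def zero_le_mult_iff)
  qed
  also have "\<dots> = ennreal (c powr a) *
      (\<integral>\<^sup>+t. ennreal (indicator {0..} t * t powr (a - 1) * exp (- c * t)) \<partial>lborel)"
  proof -
    have "c * c powr (a - 1) = c powr a"
      using c by (simp add: powr_diff)
    then show ?thesis
      using c by (subst nn_integral_cmult) (auto simp: mult.assoc[symmetric] ennreal_mult'[symmetric])
  qed
  finally have eq: "ennreal (Gamma a) = ennreal (c powr a) *
      (\<integral>\<^sup>+t. ennreal (indicator {0..} t * t powr (a - 1) * exp (- c * t)) \<partial>lborel)" (is "_ = _ * ?I") .
  \<comment> \<open>Multiplying by the reciprocal constant is valid whether or not \<open>?I\<close>
    is finite.\<close>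
  have "ennreal (Gamma a / c powr a) = ennreal (1 / c powr a) * ennreal (Gamma a)"
    using Gamma_real_pos[OF a] by (simp add: ennreal_mult'[symmetric])
  also have "\<dots> = (ennreal (1 / c powr a) * ennreal (c powr a)) * ?I"
    unfolding eq by (simp add: mult.assoc)
  also have "ennreal (1 / c powr a) * ennreal (c powr a) = 1"
    using c by (simp add: ennreal_mult'[symmetric])
  finally show ?thesis by simp
qed

section \<open>The law of Z and generalized gamma tails\<close>

lemma Z_density_nonneg:
  assumes "0 < r" "r < 1" "0 < \<mu>"
  shows "0 \<le> Z_density r \<mu> z"
  using Gamma_real_pos[of r] Gamma_real_pos[of "1 - r"] assms by (simp add: Z_density_def)

lemma borel_measurable_gg_density [measurable]: "gg_density r \<alpha> l \<in> borel_measurable borel"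
  unfolding gg_density_def by measurable

lemma borel_measurable_Z_density [measurable]: "Z_density r \<mu> \<in> borel_measurable borel"
  unfolding Z_density_def by measurable

lemma sets_GG [measurable_cong, simp]: "sets (GG r \<alpha> l) = sets borel"
  and space_GG [simp]: "space (GG r \<alpha> l) = UNIV"
  by (simp_all add: GG_def)

lemma sets_Zlaw [measurable_cong, simp]: "sets (Zlaw r \<mu>) = sets borel"
  and space_Zlaw [simp]: "space (Zlaw r \<mu>) = UNIV"
  by (simp_all add: Zlaw_def)

lemma AE_Zlaw_pos:
  assumes "0 < \<mu>"
  shows "AE z in Zlaw r \<mu>. 0 < z"
  unfolding Zlaw_def using assms
  by (subst AE_density) (auto simp: Z_density_def split: if_splits)

text \<open>The integrand is the derivative of \<open>- exp (- v^\<alpha> z)\<close>, which vanishes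
  at infinity. This form brings out a factor \<open>z\<close>, which will cancel the one in
  \<open>Z_density\<close>.\<close>

lemma nn_integral_Weibull_tail:
  fixes x z \<alpha> :: real
  assumes "0 < x" "0 < z" "0 < \<alpha>"
  shows "(\<integral>\<^sup>+v. ennreal (\<alpha> * v powr (\<alpha> - 1) * z * exp (- (v powr \<alpha>) * z)) * indicator {x..} v \<partial>lborel) =
         ennreal (exp (- (x powr \<alpha>) * z))"
proof -
  have "(\<integral>\<^sup>+v. ennreal (\<alpha> * v powr (\<alpha> - 1) * z * exp (- (v powr \<alpha>) * z)) * indicator {x..} v \<partial>lborel) =
      ennreal (0 - (- exp (- (x powr \<alpha>) * z)))"
  proof (rule nn_integral_FTC_atLeast)
    show "DERIV (\<lambda>v. - exp (- (v powr \<alpha>) * z)) v :> \<alpha> * v powr (\<alpha> - 1) * z * exp (- (v powr \<alpha>) * z)"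
      if "x \<le> v" for v
      using that assms by (auto intro!: derivative_eq_intros simp: powr_diff field_simps)
    show "((\<lambda>v. - exp (- (v powr \<alpha>) * z)) \<longlongrightarrow> 0) at_top"
      using assms by real_asymp
  qed (use assms in auto)
  then show ?thesis by simp
qed

text \<open>The factor \<open>z\<close> cancels against the density, and the shift
  \<open>z = \<mu> + t\<close> leaves a Gamma integral of shape \<open>1 - r\<close>, whose value
  cancels \<open>Gamma (1 - r)\<close>.\<close>

lemma nn_integral_Z_density_Laplace:
  assumes r: "0 < r" "r < 1" and \<mu>: "0 < \<mu>" and y: "0 < y"
  shows "(\<integral>\<^sup>+z. ennreal (Z_density r \<mu> z * z * exp (- y * z)) \<partial>lborel) =
         ennreal (\<mu> powr r / Gamma r * y powr (r - 1) * exp (- y * \<mu>))"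
proof -
  let ?C = "\<mu> powr r / (Gamma (1 - r) * Gamma r)"
  have G: "0 < Gamma r" "0 < Gamma (1 - r)" using r by (auto intro: Gamma_real_pos)
  have "(\<integral>\<^sup>+z. ennreal (Z_density r \<mu> z * z * exp (- y * z)) \<partial>lborel) =
      ennreal 1 * (\<integral>\<^sup>+t. ennreal (Z_density r \<mu> (\<mu> + 1 * t) * (\<mu> + 1 * t) * exp (- y * (\<mu> + 1 * t))) \<partial>lborel)"
    by (subst nn_integral_real_affine[where c = 1 and t = \<mu>]) auto
  also have "\<dots> = (\<integral>\<^sup>+t. ennreal (?C * exp (- y * \<mu>)) *
      ennreal (indicator {0..} t * t powr ((1 - r) - 1) * exp (- y * t)) \<partial>lborel)"
    unfolding ennreal_1 mult_1
  proof (intro nn_integral_cong)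
    fix t :: real
    show "ennreal (Z_density r \<mu> (\<mu> + t) * (\<mu> + t) * exp (- y * (\<mu> + t))) =
      ennreal (?C * exp (- y * \<mu>)) * ennreal (indicator {0..} t * t powr ((1 - r) - 1) * exp (- y * t))"
    proof (cases "0 \<le> t")
      case True
      have "exp (- y * (\<mu> + t)) = exp (- y * \<mu>) * exp (- y * t)"
        by (simp add: exp_add[symmetric] algebra_simps)
      \<comment> \<open>Also true at \<open>t = 0\<close>: division by zero on the left and
        \<open>0 powr (- r)\<close> on the right both give \<open>0\<close>.\<close>
      moreover have "Z_density r \<mu> (\<mu> + t) * (\<mu> + t) = ?C * t powr (- r)"
        using True \<mu> by (simp add: Z_density_def powr_minus_divide)
      ultimately show ?thesis
        using True G by (subst ennreal_mult'[symmetric]) (auto simp: mult_ac)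
    qed (simp add: Z_density_def)
  qed
  also have "\<dots> = ennreal (?C * exp (- y * \<mu>)) * ennreal (Gamma (1 - r) / y powr (1 - r))"
    using r y by (subst nn_integral_cmult) (auto simp: nn_integral_Gamma_scaled[of "1 - r" y, simplified])
  also have "\<dots> = ennreal (\<mu> powr r / Gamma r * y powr (r - 1) * exp (- y * \<mu>))"
    using G y by (subst ennreal_mult'[symmetric]) (auto simp: powr_diff field_simps)
  finally show ?thesis .
qed

text \<open>Tonelli on nonnegative integrals. Neither law is yet known to have mass one; that will
  be deduced from this identity.\<close>

lemma emeasure_GG_tail:
  assumes \<alpha>: "0 < \<alpha>" and r: "0 < r" "r < 1" and \<mu>: "0 < \<mu>" and x: "0 < x"
  shows "emeasure (GG r \<alpha> \<mu>) {x<..} = (\<integral>\<^sup>+z. ennreal (exp (- (x powr \<alpha>) * z)) \<partial>Zlaw r \<mu>)"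
proof -
  let ?k = "\<lambda>v z. \<alpha> * v powr (\<alpha> - 1) * z * exp (- (v powr \<alpha>) * z)"
  have Zn: "0 \<le> Z_density r \<mu> z" for z
    using Z_density_nonneg[OF r \<mu>] .
  have "(\<integral>\<^sup>+z. ennreal (exp (- (x powr \<alpha>) * z)) \<partial>Zlaw r \<mu>) =
      (\<integral>\<^sup>+z. ennreal (Z_density r \<mu> z) * ennreal (exp (- (x powr \<alpha>) * z)) \<partial>lborel)"
    unfolding Zlaw_def by (rule nn_integral_density) auto
  also have "\<dots> = (\<integral>\<^sup>+z. \<integral>\<^sup>+v. ennreal (Z_density r \<mu> z) * (ennreal (?k v z) * indicator {x..} v) \<partial>lborel \<partial>lborel)"
  proof (intro nn_integral_cong)
    fix z :: real
    show "ennreal (Z_density r \<mu> z) * ennreal (exp (- (x powr \<alpha>) * z)) =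
        (\<integral>\<^sup>+v. ennreal (Z_density r \<mu> z) * (ennreal (?k v z) * indicator {x..} v) \<partial>lborel)"
    proof (cases "\<mu> \<le> z")
      case True
      then show ?thesis
        using \<mu> \<alpha> x nn_integral_Weibull_tail[of x z \<alpha>] by (subst nn_integral_cmult) auto
    next
      case False
      then show ?thesis by (simp add: Z_density_def)
    qed
  qed
  also have "\<dots> = (\<integral>\<^sup>+v. \<integral>\<^sup>+z. ennreal (Z_density r \<mu> z) * (ennreal (?k v z) * indicator {x..} v) \<partial>lborel \<partial>lborel)"
    by (rule lborel_pair.Fubini') measurable
  also have "\<dots> = (\<integral>\<^sup>+v. ennreal (gg_density r \<alpha> \<mu> v) * indicator {x..} v \<partial>lborel)"
  proof (intro nn_integral_cong)
    fix v :: real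
    show "(\<integral>\<^sup>+z. ennreal (Z_density r \<mu> z) * (ennreal (?k v z) * indicator {x..} v) \<partial>lborel) =
        ennreal (gg_density r \<alpha> \<mu> v) * indicator {x..} v"
    proof (cases "x \<le> v")
      case True
      then have v: "0 < v" using x by simp
      have "(\<integral>\<^sup>+z. ennreal (Z_density r \<mu> z) * (ennreal (?k v z) * indicator {x..} v) \<partial>lborel) =
          (\<integral>\<^sup>+z. ennreal (\<alpha> * v powr (\<alpha> - 1)) * ennreal (Z_density r \<mu> z * z * exp (- (v powr \<alpha>) * z)) \<partial>lborel)"
        using True \<alpha> Zn by (intro nn_integral_cong) (auto simp: ennreal_mult'[symmetric] mult_ac)
      also have "\<dots> = ennreal (\<alpha> * v powr (\<alpha> - 1)) *
          ennreal (\<mu> powr r / Gamma r * (v powr \<alpha>) powr (r - 1) * exp (- (v powr \<alpha>) * \<mu>))"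
        using nn_integral_Z_density_Laplace[OF r \<mu>, of "v powr \<alpha>"] v
        by (subst nn_integral_cmult) auto
      also have "\<dots> = ennreal (gg_density r \<alpha> \<mu> v)"
      proof -
        have "v powr (\<alpha> - 1) * (v powr \<alpha>) powr (r - 1) = v powr (\<alpha> * r - 1)"
          by (simp add: powr_powr powr_add[symmetric] algebra_simps)
        then have "\<alpha> * v powr (\<alpha> - 1) * (\<mu> powr r / Gamma r * (v powr \<alpha>) powr (r - 1) * exp (- (v powr \<alpha>) * \<mu>))
            = gg_density r \<alpha> \<mu> v"
          using v \<alpha> by (simp add: gg_density_def mult_ac)
        then show ?thesis using \<alpha> by (subst ennreal_mult'[symmetric]) auto
      qed
      finally show ?thesis using True by simp
    qed simp
  qed
  also have "\<dots> = (\<integral>\<^sup>+v. ennreal (gg_density r \<alpha> \<mu> v) * indicator {x<..} v \<partial>lborel)"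
    using AE_lborel_singleton[of x]
    by (intro nn_integral_cong_AE) (auto simp: indicator_def elim!: eventually_mono)
  also have "\<dots> = emeasure (GG r \<alpha> \<mu>) {x<..}"
    unfolding GG_def by (subst emeasure_density) auto
  finally show ?thesis by simp
qed

text \<open>The tail identity as \<open>x\<close> decreases to \<open>0\<close>, with monotone
  limits on both sides. It transfers total mass between the two laws, for every
  \<open>\<alpha> > 0\<close>.\<close>

lemma emeasure_GG_pos_eq_Zlaw:
  assumes \<alpha>: "0 < \<alpha>" and r: "0 < r" "r < 1" and \<mu>: "0 < \<mu>"
  shows "emeasure (GG r \<alpha> \<mu>) {0<..} = emeasure (Zlaw r \<mu>) UNIV"
proof -
  define x where "x n = 1 / real (Suc n)" for n
  have x: "0 < x n" for n by (simp add: x_def)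
  have decx: "x n \<le> x m" if "m \<le> n" for m n
    using that by (simp add: x_def frac_le)
  have limx: "x \<longlonglongrightarrow> 0" unfolding x_def by (rule LIMSEQ_Suc[OF lim_1_over_n])
  have limxa: "(\<lambda>n. x n powr \<alpha>) \<longlonglongrightarrow> 0"
    using tendsto_powr2[OF limx tendsto_const, of \<alpha>] \<alpha> x by (simp add: less_imp_le)
  have U: "(\<Union>n. {x n<..}) = {0<..}"
  proof safe
    fix y :: real assume "y > 0"
    then obtain n where "x n < y"
      using order_tendstoD(2)[OF limx] by (metis eventually_happens trivial_limit_sequentially)
    then show "y \<in> (\<Union>n. {x n<..})" by auto
  qed (use x less_trans in \<open>auto\<close>)
  have "(\<lambda>n. emeasure (GG r \<alpha> \<mu>) {x n<..}) \<longlonglongrightarrow> emeasure (GG r \<alpha> \<mu>) (\<Union>n. {x n<..})"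
    by (rule Lim_emeasure_incseq) (auto simp: incseq_def decx)
  \<comment> \<open>Replacing \<open>z\<close> by \<open>|z|\<close> makes the integrands increase
    in \<open>n\<close> for every \<open>z\<close>, not only almost everywhere.\<close>
  moreover have "emeasure (GG r \<alpha> \<mu>) {x n<..} =
      (\<integral>\<^sup>+z. ennreal (exp (- (x n powr \<alpha>) * \<bar>z\<bar>)) \<partial>Zlaw r \<mu>)" for n
    unfolding emeasure_GG_tail[OF \<alpha> r \<mu> x]
    using eventually_mono[OF AE_Zlaw_pos[OF \<mu>, of r]] by (intro nn_integral_cong_AE) auto
  moreover have "(\<lambda>n. \<integral>\<^sup>+z. ennreal (exp (- (x n powr \<alpha>) * \<bar>z\<bar>)) \<partial>Zlaw r \<mu>) \<longlonglongrightarrow>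
      (\<integral>\<^sup>+z. 1 \<partial>Zlaw r \<mu>)"
  proof (rule nn_integral_LIMSEQ)
    show "incseq (\<lambda>n z. ennreal (exp (- (x n powr \<alpha>) * \<bar>z\<bar>)))"
      using \<alpha> x decx
      by (auto simp: incseq_def le_fun_def less_imp_le intro!: ennreal_leI mult_right_mono powr_mono2)
    show "(\<lambda>n. ennreal (exp (- (x n powr \<alpha>) * \<bar>z\<bar>))) \<longlonglongrightarrow> 1" for z
    proof -
      have "(\<lambda>n. exp (- (x n powr \<alpha>) * \<bar>z\<bar>)) \<longlonglongrightarrow> exp (- 0 * \<bar>z\<bar>)"
        by (intro tendsto_intros limxa)
      then show ?thesis using tendsto_ennrealI by fastforce
    qed
  qed auto
  ultimately show ?thesis
    unfolding U using LIMSEQ_unique by fastforce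
qed

text \<open>For \<open>\<alpha> = 1\<close> the generalized gamma law is the ordinary gamma law,
  whose mass is a Gamma integral; transferring it evaluates the integral of \<open>Z_density\<close>
  without a Beta integral.\<close>

lemma prob_space_Zlaw:
  assumes r: "0 < r" "r < 1" and \<mu>: "0 < \<mu>"
  shows "prob_space (Zlaw r \<mu>)"
proof
  have G: "0 < Gamma r" using r by (intro Gamma_real_pos)
  have "emeasure (Zlaw r \<mu>) (space (Zlaw r \<mu>)) = emeasure (GG r 1 \<mu>) {0<..}"
    using emeasure_GG_pos_eq_Zlaw[OF _ r \<mu>, of 1] by simp
  also have "\<dots> = (\<integral>\<^sup>+v. ennreal (gg_density r 1 \<mu> v) * indicator {0<..} v \<partial>lborel)"
    unfolding GG_def by (subst emeasure_density) auto
  also have "\<dots> = (\<integral>\<^sup>+v. ennreal (\<mu> powr r / Gamma r) *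
      ennreal (indicator {0..} v * v powr (r - 1) * exp (- \<mu> * v)) \<partial>lborel)"
    using G by (intro nn_integral_cong)
      (auto simp: gg_density_def ennreal_mult'[symmetric] indicator_def mult_ac)
  also have "\<dots> = ennreal (\<mu> powr r / Gamma r) * ennreal (Gamma r / \<mu> powr r)"
    using nn_integral_Gamma_scaled[OF r(1) \<mu>] by (subst nn_integral_cmult) auto
  also have "\<dots> = 1"
    using G \<mu> by (simp add: ennreal_mult'[symmetric])
  finally show "emeasure (Zlaw r \<mu>) (space (Zlaw r \<mu>)) = 1" .
qed

text \<open>Mass one is carried back from \<open>Zlaw\<close> to every
  \<open>\<alpha> > 0\<close>.\<close>

lemma real_distribution_GG:
  assumes \<alpha>: "0 < \<alpha>" and r: "0 < r" "r < 1" and \<mu>: "0 < \<mu>"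
  shows "real_distribution (GG r \<alpha> \<mu>)" and "emeasure (GG r \<alpha> \<mu>) {0<..} = 1"
proof -
  interpret Z: prob_space "Zlaw r \<mu>" by (rule prob_space_Zlaw[OF r \<mu>])
  show 1: "emeasure (GG r \<alpha> \<mu>) {0<..} = 1"
    using emeasure_GG_pos_eq_Zlaw[OF \<alpha> r \<mu>] Z.emeasure_space_1 by simp
  have "AE x in lborel. x \<noteq> 0 \<longrightarrow> ennreal (gg_density r \<alpha> \<mu> x) = ennreal (gg_density r \<alpha> \<mu> x) * indicator {0<..} x"
    by (auto simp: gg_density_def indicator_def)
  then have "AE x in lborel. ennreal (gg_density r \<alpha> \<mu> x) = ennreal (gg_density r \<alpha> \<mu> x) * indicator {0<..} x"
    using AE_lborel_singleton[of "0::real"] by eventually_elim auto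
  then have "emeasure (GG r \<alpha> \<mu>) UNIV = emeasure (GG r \<alpha> \<mu>) {0<..}"
    unfolding GG_def by (simp add: emeasure_density cong: nn_integral_cong_AE)
  then have "prob_space (GG r \<alpha> \<mu>)"
    by (intro prob_spaceI) (simp add: 1)
  then show "real_distribution (GG r \<alpha> \<mu>)"
    by (simp add: real_distribution_def real_distribution_axioms_def)
qed

lemma measure_GG_tail:
  assumes \<alpha>: "0 < \<alpha>" and r: "0 < r" "r < 1" and \<mu>: "0 < \<mu>" and x: "0 \<le> x"
  shows "measure (GG r \<alpha> \<mu>) {x<..} = (LINT z|Zlaw r \<mu>. exp (- (x powr \<alpha>) * z))"
proof -
  interpret Z: prob_space "Zlaw r \<mu>" by (rule prob_space_Zlaw[OF r \<mu>])
  show ?thesis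
  proof (cases "x = 0")
    \<comment> \<open>Here \<open>0 powr \<alpha> = 0\<close> makes the right side the mass of
      \<open>Zlaw r \<mu>\<close>, which matches the mass of the open half-line.\<close>
    case True
    then show ?thesis
      using real_distribution_GG(2)[OF \<alpha> r \<mu>] Z.prob_space by (simp add: measure_def)
  next
    case False
    then have "measure (GG r \<alpha> \<mu>) {x<..} = enn2real (\<integral>\<^sup>+z. ennreal (exp (- (x powr \<alpha>) * z)) \<partial>Zlaw r \<mu>)"
      using emeasure_GG_tail[OF \<alpha> r \<mu>, of x] x by (simp add: measure_def)
    also have "\<dots> = (LINT z|Zlaw r \<mu>. exp (- (x powr \<alpha>) * z))"
      by (rule integral_eq_nn_integral[symmetric]) auto
    finally show ?thesis .
  qed
qed

section \<open>Mixed exponential laws\<close>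

lemma measure_exponential_tail: "0 \<le> a \<Longrightarrow> measure Exp1 {a<..} = exp (- a)"
  and prob_space_Exp1: "prob_space Exp1"
proof -
  show *: "prob_space Exp1"
    unfolding Exp1_def by (rule prob_space_exponential_density) simp
  interpret prob_space Exp1 by fact
  have "distributed Exp1 lborel (\<lambda>x. x) (exponential_density 1)"
    by (auto simp: distributed_def Exp1_def distr_id2)
  from exponential_distributedD_gt[OF this] show "measure Exp1 {a<..} = exp (- a)" if "0 \<le> a"
    using that by (simp add: Exp1_def greaterThan_def)
qed

lemma sets_Exp1 [measurable_cong, simp]: "sets Exp1 = sets borel"
  and space_Exp1 [simp]: "space Exp1 = UNIV"
  by (simp_all add: Exp1_def)

text \<open>For fixed \<open>p\<close> with \<open>V p > 0\<close>, the event
  \<open>w / V p > x\<close> is \<open>w > V p * x\<close>; its exponential probability is then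
  averaged over \<open>p\<close>.\<close>

lemma exponential_ratio_tail:
  assumes "prob_space P" and [measurable]: "V \<in> borel_measurable P"
    and pos: "AE p in P. 0 < V p" and x: "0 \<le> x"
  shows "measure (distr (Exp1 \<Otimes>\<^sub>M P) borel (\<lambda>(w, p). w / V p)) {x<..} = (LINT p|P. exp (- V p * x))"
proof -
  interpret P: prob_space P by fact
  interpret E: prob_space Exp1 by (rule prob_space_Exp1)
  interpret Q: pair_prob_space Exp1 P ..
  let ?A = "(\<lambda>(w, p). w / V p) -` {x<..} \<inter> space (Exp1 \<Otimes>\<^sub>M P)"
  have "emeasure (distr (Exp1 \<Otimes>\<^sub>M P) borel (\<lambda>(w, p). w / V p)) {x<..} = emeasure (Exp1 \<Otimes>\<^sub>M P) ?A"
    by (subst emeasure_distr) auto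
  also have "\<dots> = (\<integral>\<^sup>+p. emeasure Exp1 ((\<lambda>w. (w, p)) -` ?A) \<partial>P)"
    by (rule Q.emeasure_pair_measure_alt2) measurable
  also have "\<dots> = (\<integral>\<^sup>+p. ennreal (exp (- V p * x)) \<partial>P)"
  proof (rule nn_integral_cong_AE)
    show "AE p in P. emeasure Exp1 ((\<lambda>w. (w, p)) -` ?A) = ennreal (exp (- V p * x))"
      using pos AE_space
    proof eventually_elim
      case (elim p)
      then have "(\<lambda>w. (w, p)) -` ?A = {V p * x<..}"
        by (auto simp: space_pair_measure field_simps)
      then show ?case
        using measure_exponential_tail[of "V p * x"] elim x by (simp add: E.emeasure_eq_measure)
    qed
  qed
  finally have "measure (distr (Exp1 \<Otimes>\<^sub>M P) borel (\<lambda>(w, p). w / V p)) {x<..} =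
      enn2real (\<integral>\<^sup>+p. ennreal (exp (- V p * x)) \<partial>P)"
    by (simp add: measure_def)
  also have "\<dots> = (LINT p|P. exp (- V p * x))"
    by (rule integral_eq_nn_integral[symmetric]) auto
  finally show ?thesis .
qed

text \<open>Full mass on the positive half-line pins the tails at negative \<open>x\<close> between
  the tail at \<open>0\<close> and \<open>1\<close>, so the distribution functions agree
  everywhere.\<close>

lemma real_distribution_eq_by_tails:
  assumes M: "real_distribution M" and N: "real_distribution N"
    and tails: "\<And>x. 0 \<le> x \<Longrightarrow> measure M {x<..} = measure N {x<..}"
    and pos: "measure M {0<..} = 1"
  shows "M = N"
proof (rule cdf_unique[OF M N])
  interpret M: real_distribution M by fact
  interpret N: real_distribution N by fact
  have "measure M {x<..} = measure N {x<..}" for x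
  proof (cases "0 \<le> x")
    case False
    then have "measure M {0<..} \<le> measure M {x<..}" "measure N {0<..} \<le> measure N {x<..}"
      by (auto intro!: M.finite_measure_mono N.finite_measure_mono)
    then show ?thesis
      using pos tails[of 0] M.prob_le_1[of "{x<..}"] N.prob_le_1[of "{x<..}"] by linarith
  qed (rule tails)
  moreover have "cdf M x = 1 - measure M {x<..}" "cdf N x = 1 - measure N {x<..}" for x
    using M.prob_compl[of "{x<..}"] N.prob_compl[of "{x<..}"]
    by (simp_all add: cdf_def Compl_eq_Diff_UNIV[symmetric] not_less[symmetric])
  ultimately show "cdf M = cdf N" by auto
qed

text \<open>Given \<open>z > 0\<close>, the Laplace transform of \<open>S\<close> at
  \<open>z powr (1 / \<alpha>) * x\<close> is \<open>exp (- z * x powr \<alpha>)\<close>: the power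
  \<open>1 / \<alpha>\<close> undoes the stable exponent.\<close>

lemma stable_mixture_GG_tail:
  assumes S: "one_sided_stable \<alpha> S" and \<alpha>: "0 < \<alpha>" "\<alpha> \<le> 1" and r: "0 < r" "r < 1" and \<mu>: "0 < \<mu>"
    and x: "0 \<le> x"
  shows "(LINT p|(S \<Otimes>\<^sub>M Zlaw r \<mu>). exp (- (fst p * snd p powr (1 / \<alpha>)) * x)) = measure (GG r \<alpha> \<mu>) {x<..}"
proof -
  interpret S: real_distribution S using S by (simp add: one_sided_stable_def)
  interpret Z: prob_space "Zlaw r \<mu>" by (rule prob_space_Zlaw[OF r \<mu>])
  interpret P: pair_prob_space S "Zlaw r \<mu>" ..
  let ?f = "\<lambda>p. exp (- (fst p * snd p powr (1 / \<alpha>)) * x)"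
  have pos: "AE p in S \<Otimes>\<^sub>M Zlaw r \<mu>. 0 \<le> fst p"
  proof (rule P.AE_pair_measure)
    show "AE s in S. AE z in Zlaw r \<mu>. 0 \<le> fst (s, z)"
      using one_sided_stable_pos[OF S \<alpha>] by eventually_elim simp
  qed measurable
  have "integrable (S \<Otimes>\<^sub>M Zlaw r \<mu>) ?f"
    by (rule P.integrable_const_bound[where B = 1]) (use pos x in \<open>auto elim!: eventually_mono\<close>)
  then have "(LINT p|(S \<Otimes>\<^sub>M Zlaw r \<mu>). ?f p) = (LINT z|Zlaw r \<mu>. LINT s|S. ?f (s, z))"
    using P.integral_snd[of "\<lambda>s z. ?f (s, z)"] by (simp add: case_prod_unfold)
  also have "\<dots> = (LINT z|Zlaw r \<mu>. exp (- (x powr \<alpha>) * z))"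
  proof (rule integral_cong_AE)
    have L: "(LINT s|S. ?f (s, z)) = exp (- ((z powr (1 / \<alpha>) * x) powr \<alpha>))" for z
      using one_sided_stable_Laplace[OF S \<alpha>, of "z powr (1 / \<alpha>) * x"] x by (simp add: mult_ac)
    show "AE z in Zlaw r \<mu>. (LINT s|S. ?f (s, z)) = exp (- (x powr \<alpha>) * z)"
      unfolding L using AE_Zlaw_pos[OF \<mu>]
      by eventually_elim (use \<alpha> x in \<open>auto simp: powr_mult powr_powr\<close>)
  qed measurable
  finally show ?thesis
    using measure_GG_tail[OF \<alpha>(1) r \<mu> x] by simp
qed

text \<open>One identity, the tail as the mean of \<open>exp (- V x)\<close> with
  \<open>V = S Z^(1/\<alpha>)\<close>, serves both claims.\<close>

lemma GG_stable_representation: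
  assumes S: "one_sided_stable \<alpha> S" and \<alpha>: "0 < \<alpha>" "\<alpha> \<le> 1" and r: "0 < r" "r < 1" and \<mu>: "0 < \<mu>"
  shows "GG r \<alpha> \<mu> = distr (Exp1 \<Otimes>\<^sub>M (S \<Otimes>\<^sub>M Zlaw r \<mu>)) borel (\<lambda>(w, s, z). w / (s * z powr (1 / \<alpha>)))"
    and "mixed_exponential (GG r \<alpha> \<mu>)"
proof -
  interpret S: real_distribution S using S by (simp add: one_sided_stable_def)
  interpret Z: prob_space "Zlaw r \<mu>" by (rule prob_space_Zlaw[OF r \<mu>])
  interpret P: pair_prob_space S "Zlaw r \<mu>" ..
  interpret E: prob_space Exp1 by (rule prob_space_Exp1)
  interpret Q: pair_prob_space Exp1 "S \<Otimes>\<^sub>M Zlaw r \<mu>" ..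
  interpret G: real_distribution "GG r \<alpha> \<mu>" by (rule real_distribution_GG(1)[OF \<alpha>(1) r \<mu>])
  define V where "V p = fst p * snd p powr (1 / \<alpha>)" for p :: "real \<times> real"
  have V [measurable]: "V \<in> borel_measurable (S \<Otimes>\<^sub>M Zlaw r \<mu>)"
    unfolding V_def by measurable
  have pos: "AE p in S \<Otimes>\<^sub>M Zlaw r \<mu>. 0 < V p"
  proof (rule P.AE_pair_measure)
    show "AE s in S. AE z in Zlaw r \<mu>. 0 < V (s, z)"
      using one_sided_stable_pos[OF S \<alpha>]
    proof eventually_elim
      case (elim s)
      show ?case using AE_Zlaw_pos[OF \<mu>]
        by eventually_elim (use elim in \<open>auto simp: V_def\<close>)
    qed
  qed measurable
  have tail: "(LINT p|(S \<Otimes>\<^sub>M Zlaw r \<mu>). exp (- V p * x)) = measure (GG r \<alpha> \<mu>) {x<..}" if "0 \<le> x" for x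
    unfolding V_def by (rule stable_mixture_GG_tail[OF S \<alpha> r \<mu> that])
  have G0: "measure (GG r \<alpha> \<mu>) {0<..} = 1"
    using real_distribution_GG(2)[OF \<alpha>(1) r \<mu>] by (simp add: measure_def)
  let ?N = "distr (Exp1 \<Otimes>\<^sub>M (S \<Otimes>\<^sub>M Zlaw r \<mu>)) borel (\<lambda>(w, p). w / V p)"
  have "GG r \<alpha> \<mu> = ?N"
  proof (rule real_distribution_eq_by_tails[OF _ _ _ G0])
    show "measure (GG r \<alpha> \<mu>) {x<..} = measure ?N {x<..}" if "0 \<le> x" for x
      using exponential_ratio_tail[OF P.prob_space_axioms V pos that] tail[OF that] by simp
    show "real_distribution ?N"
      by (auto simp: real_distribution_def real_distribution_axioms_def intro!: Q.prob_space_distr)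
  qed (rule G.real_distribution_axioms)
  also have "(\<lambda>(w, p). w / V p) = (\<lambda>(w, s, z). w / (s * z powr (1 / \<alpha>)))"
    by (auto simp: V_def)
  finally show "GG r \<alpha> \<mu> = distr (Exp1 \<Otimes>\<^sub>M (S \<Otimes>\<^sub>M Zlaw r \<mu>)) borel (\<lambda>(w, s, z). w / (s * z powr (1 / \<alpha>)))" .
  \<comment> \<open>Given \<open>V\<close>, the ratio is exponential with rate \<open>V\<close>, so
    the mixing law is that of \<open>V\<close> and not of its reciprocal.\<close>
  let ?H = "distr (S \<Otimes>\<^sub>M Zlaw r \<mu>) borel V"
  have "real_distribution ?H"
    by (auto simp: real_distribution_def real_distribution_axioms_def intro!: P.prob_space_distr)
  moreover have "measure ?H {..0} = 0"
  proof -
    have "AE v in ?H. v \<notin> {..0}"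
      using pos by (subst AE_distr_iff) (auto simp: not_le)
    then have "emeasure ?H {..0} = 0"
      by (subst (asm) AE_iff_measurable[where N = "{..0}"]) auto
    then show ?thesis by (simp add: measure_def)
  qed
  moreover have "measure (GG r \<alpha> \<mu>) {x<..} = (LINT v|?H. exp (- v * x))" if "0 \<le> x" for x
    using tail[OF that] by (subst integral_distr) auto
  moreover have "measure (GG r \<alpha> \<mu>) {..<0} = 0"
  proof -
    have "measure (GG r \<alpha> \<mu>) {..<0} \<le> measure (GG r \<alpha> \<mu>) (space (GG r \<alpha> \<mu>) - {0<..})"
      by (rule G.finite_measure_mono) auto
    also have "\<dots> = 0" using G.prob_compl[of "{0<..}"] G0 by simp
    finally show ?thesis by (simp add: measure_le_0_iff)
  qed
  ultimately show "mixed_exponential (GG r \<alpha> \<mu>)"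
    unfolding mixed_exponential_def using G.real_distribution_axioms by blast
qed

text \<open>The difference \<open>exp (- z c) - exp (- z (c + h))\<close> is
  \<open>exp (- z c) (1 - exp (- z h))\<close>, whose first factor is at most \<open>1\<close>. This
  is the decrease of a mixed exponential density in integrated form.\<close>

lemma mixed_exponential_interval_le:
  assumes "mixed_exponential M" and c: "0 \<le> c" and h: "0 \<le> h"
  shows "measure M {c<..c + h} \<le> measure M {0<..h}"
proof -
  interpret M: real_distribution M using assms by (simp add: mixed_exponential_def)
  obtain H where H: "real_distribution H" "measure H {..0} = 0"
    and tail: "\<And>x. 0 \<le> x \<Longrightarrow> measure M {x<..} = (LINT z|H. exp (- z * x))"
    using assms by (auto simp: mixed_exponential_def)
  interpret H: real_distribution H by fact
  have "emeasure H {..0} = 0" using H(2) by (simp add: H.emeasure_eq_measure)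
  then have pos: "AE z in H. 0 < z"
    by (intro AE_I[where N = "{..0}"]) auto
  have int: "integrable H (\<lambda>z. exp (- z * x))" if "0 \<le> x" for x
    by (rule H.integrable_const_bound[where B = 1]) (use pos that in \<open>auto elim!: eventually_mono\<close>)
  have interval: "measure M {a<..a + h} = (LINT z|H. exp (- z * a) - exp (- z * (a + h)))" if "0 \<le> a" for a
  proof -
    have "measure M {a<..a + h} = measure M ({a<..} - {a + h<..})"
      by (rule arg_cong[where f = "measure M"]) auto
    also have "\<dots> = measure M {a<..} - measure M {a + h<..}"
      using h by (intro M.finite_measure_Diff) auto
    also have "\<dots> = (LINT z|H. exp (- z * a) - exp (- z * (a + h)))"
      using tail[OF that] tail[of "a + h"] int[OF that] int[of "a + h"] that h by simp
    finally show ?thesis .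
  qed
  have "(LINT z|H. exp (- z * c) - exp (- z * (c + h))) \<le> (LINT z|H. exp (- z * 0) - exp (- z * (0 + h)))"
  proof (rule integral_mono_AE)
    show "AE z in H. exp (- z * c) - exp (- z * (c + h)) \<le> exp (- z * 0) - exp (- z * (0 + h))"
      using pos
    proof eventually_elim
      case (elim z)
      have "exp (- z * c) * (1 - exp (- z * h)) \<le> 1 * (1 - exp (- z * h))"
        using elim c h by (intro mult_right_mono) auto
      then show ?case by (simp add: algebra_simps exp_add[symmetric])
    qed
  qed (use c h int in \<open>auto simp del: mult_minus_left\<close>)
  then show ?thesis using interval[OF c] interval[of 0] by simp
qed

lemma GG_not_mixed_exponential:
  assumes \<alpha>: "0 < \<alpha>" and r: "0 < r" and \<mu>: "0 < \<mu>" and \<alpha>r: "1 < \<alpha> * r"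
  shows "\<not> mixed_exponential (GG r \<alpha> \<mu>)"
proof
  assume mix: "mixed_exponential (GG r \<alpha> \<mu>)"
  interpret G: real_distribution "GG r \<alpha> \<mu>" using mix by (simp add: mixed_exponential_def)
  define C where "C = \<alpha> * \<mu> powr r / Gamma r"
  have C: "0 < C" using \<alpha> \<mu> Gamma_real_pos[OF r] by (simp add: C_def)
  \<comment> \<open>A lower bound for the exponential factor of the density on
    \<open>(1, 2]\<close>, which contains \<open>(1, 1 + h]\<close> once
    \<open>h \<le> 1\<close>.\<close>
  define \<delta> where "\<delta> = exp (- \<mu> * 2 powr \<alpha>)"
  have \<delta>: "0 < \<delta>" "\<delta> < 1" using \<mu> by (auto simp: \<delta>_def)
  \<comment> \<open>Solves \<open>h powr (\<alpha> * r - 1) = \<delta> / 2\<close>, so that the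
    density is at most \<open>C * \<delta> / 2\<close> on \<open>(0, h]\<close> but at least
    \<open>C * \<delta>\<close> on \<open>(1, 1 + h]\<close>. The exponent is positive and
    \<open>\<delta> < 1\<close>, whence \<open>h \<le> 1\<close>.\<close>
  define h where "h = (\<delta> / 2) powr (1 / (\<alpha> * r - 1))"
  have "h \<le> 1 powr (1 / (\<alpha> * r - 1))"
    unfolding h_def using \<delta> \<alpha>r by (intro powr_mono2) auto
  then have h: "0 < h" "h \<le> 1"
    using \<delta> by (auto simp: h_def)
  have h_powr: "h powr (\<alpha> * r - 1) = \<delta> / 2"
    using \<delta> \<alpha>r by (simp add: h_def powr_powr)
  have dens: "gg_density r \<alpha> \<mu> v = C * v powr (\<alpha> * r - 1) * exp (- \<mu> * v powr \<alpha>)" if "0 \<le> v" for v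
    using that \<alpha> by (simp add: gg_density_def C_def)
  have "emeasure (GG r \<alpha> \<mu>) {0<..h} \<le> (\<integral>\<^sup>+v. ennreal (C * (\<delta> / 2)) * indicator {0<..h} v \<partial>lborel)"
    unfolding GG_def
  proof (subst emeasure_density, simp, simp, rule nn_integral_mono)
    fix v :: real
    have "gg_density r \<alpha> \<mu> v \<le> C * (\<delta> / 2)" if v: "0 < v" "v \<le> h"
    proof -
      have "C * v powr (\<alpha> * r - 1) * exp (- \<mu> * v powr \<alpha>) \<le> C * h powr (\<alpha> * r - 1) * 1"
        using v C \<mu> \<alpha>r by (intro mult_mono mult_left_mono powr_mono2) auto
      then show ?thesis using v by (simp add: dens h_powr)
    qed
    then show "ennreal (gg_density r \<alpha> \<mu> v) * indicator {0<..h} v \<le> ennreal (C * (\<delta> / 2)) * indicator {0<..h} v"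
      by (auto simp: indicator_def intro: ennreal_leI)
  qed
  also have "\<dots> = ennreal (C * (\<delta> / 2) * h)"
    using h C \<delta> by (simp add: nn_integral_cmult_indicator ennreal_mult'[symmetric])
  finally have upper: "measure (GG r \<alpha> \<mu>) {0<..h} \<le> C * (\<delta> / 2) * h"
    using C \<delta> h by (simp add: G.emeasure_eq_measure)
  have "ennreal (C * \<delta> * h) = (\<integral>\<^sup>+v. ennreal (C * \<delta>) * indicator {1<..1 + h} v \<partial>lborel)"
    using h C \<delta> by (simp add: nn_integral_cmult_indicator ennreal_mult'[symmetric])
  also have "\<dots> \<le> emeasure (GG r \<alpha> \<mu>) {1<..1 + h}"
    unfolding GG_def
  proof (subst emeasure_density, simp, simp, rule nn_integral_mono)
    fix v :: real
    have "C * \<delta> \<le> gg_density r \<alpha> \<mu> v" if v: "1 < v" "v \<le> 1 + h"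
    proof -
      have "\<mu> * v powr \<alpha> \<le> \<mu> * 2 powr \<alpha>"
        using v h \<mu> \<alpha> by (intro mult_left_mono powr_mono2) auto
      then have "C * 1 * \<delta> \<le> C * v powr (\<alpha> * r - 1) * exp (- \<mu> * v powr \<alpha>)"
        unfolding \<delta>_def using v C \<alpha>r by (intro mult_mono mult_left_mono ge_one_powr_ge_zero) auto
      then show ?thesis using v by (simp add: dens)
    qed
    then show "ennreal (C * \<delta>) * indicator {1<..1 + h} v \<le> ennreal (gg_density r \<alpha> \<mu> v) * indicator {1<..1 + h} v"
      by (auto simp: indicator_def intro: ennreal_leI)
  qed
  finally have "C * \<delta> * h \<le> measure (GG r \<alpha> \<mu>) {1<..1 + h}"
    by (simp add: G.emeasure_eq_measure)
  also have "\<dots> \<le> measure (GG r \<alpha> \<mu>) {0<..h}"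
    using h by (intro mixed_exponential_interval_le[OF mix]) auto
  finally have "C * \<delta> * h \<le> C * (\<delta> / 2) * h" using upper by linarith
  then show False using C \<delta> h by simp
qed

theorem theorem1:
  shows "(\<forall>\<alpha> r \<mu> S. 0 < \<alpha> \<and> \<alpha> \<le> 1 \<and> 0 < r \<and> r < 1 \<and> 0 < \<mu> \<and> one_sided_stable \<alpha> S \<longrightarrow>
            mixed_exponential (GG r \<alpha> \<mu>) \<and>
            GG r \<alpha> \<mu> = distr (Exp1 \<Otimes>\<^sub>M (S \<Otimes>\<^sub>M Zlaw r \<mu>)) borel
                          (\<lambda>(w, s, z). w / (s * z powr (1 / \<alpha>))))
       \<and> (\<forall>\<alpha> r \<mu>. 0 < \<alpha> \<and> 0 < r \<and> 0 < \<mu> \<and> \<alpha> * r > 1 \<longrightarrow>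
            \<not> mixed_exponential (GG r \<alpha> \<mu>))"
  using GG_stable_representation GG_not_mixed_exponential by blast

end
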